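(* If $A$ is an Artinian skew left brace (in particular, if $A$ is finite), then the skew left brace $A/\operatorname{Rad}(A)$ is isomorphic to a direct product of finitely many simple skew left braces. In particular, if furthermore $A$ is prime, then $A$ is simple if and only if $\operatorname{Rad}(A)=0$.
   Context: A skew left brace is a triple $(A,+,\circ)$ where $(A,+)$ and $(A,\circ)$ are (not necessarily abelian) groups with $a\circ(b+c)=a\circ b-a+a\circ c$ for all $a,b,c\in A$; the two groups share the same identity element, written $0$. Put $\lambda_a(b)=-a+a\circ b$ and $a*b=\lambda_a(b)-b=-a+a\circ b-b$. An ideal of $A$ is a subgroup $I$ of $(A,+)$ that is normal in $(A,+)$, satisfies $\lambda_a(I)\subseteq I$ for all $a\in A$, and is a normal subgroup of $(A,\circ)$; then $A/I$ is a skew left brace. For ideals $I,J$, $I*J$ denotes the additive subgroup generated by all $x*y$ with $x\in I$, $y\in J$. A maximal ideal is a proper ideal not contained in any other proper ideal. The radical $\operatorname{Rad}(A)$ is the intersection of all maximal ideals of $A$ if such exist, and $\operatorname{Rad}(A)=A$ otherwise. $A$ is simple if it has no ideals other than $0$ and $A$. $A$ is prime if $I*J\neq 0$ for all non-zero ideals $I,J$ of $A$. $A$ is Artinian if every descending chain of ideals of $A$ is eventually stationary. Direct products have componentwise operations. *)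

theory Defs
  imports "HOL-Algebra.AbelCoset" "HOL-Algebra.Generated_Groups"
begin

text \<open>
  A skew left brace \<open>(A, +, \<circ>)\<close> is carried by the record type of rings: \<open>\<oplus>\<close> is the (not necessarily
  commutative) operation \<open>+\<close> and \<open>\<otimes>\<close> is the operation \<open>\<circ>\<close>; thus \<open>group (add_monoid A)\<close> concerns
  \<open>(A, +)\<close> and \<open>group A\<close> concerns \<open>(A, \<circ>)\<close>.  That the two identities agree is a consequence of the
  axioms (lemma \<open>one_eq_zero\<close> below).
\<close>

locale skew_left_brace =
  fixes A :: "('a, 'm) ring_scheme" (structure)
  assumes additive_group: "group (add_monoid A)"
    and multiplicative_group: "group A"
    and brace_distrib:
      "\<lbrakk>a \<in> carrier A; b \<in> carrier A; c \<in> carrier A\<rbrakk>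
        \<Longrightarrow> a \<otimes> (b \<oplus> c) = ((a \<otimes> b) \<ominus> a) \<oplus> (a \<otimes> c)"

lemma (in skew_left_brace) one_eq_zero: "\<one> = \<zero>"
proof -
  interpret P: group "add_monoid A" by (rule additive_group)
  interpret M: group A by (rule multiplicative_group)
  have z: "\<zero> \<in> carrier A" and o: "\<one> \<in> carrier A"
    using P.one_closed by simp_all
  have "\<zero> = (\<zero> \<ominus> \<one>) \<oplus> \<zero>"
    using brace_distrib[OF o z z] P.l_one[of \<zero>] z by simp
  moreover have i: "\<ominus> \<one> \<in> carrier A"
    using P.inv_closed[of \<one>] o by (simp add: a_inv_def)
  ultimately have "\<ominus> \<one> = \<zero>"
    using P.l_one[of "\<ominus> \<one>"] P.r_one[of "\<ominus> \<one>"] by (simp add: a_minus_def)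
  then show ?thesis
    using P.r_inv[of \<one>] P.r_one[of \<one>] o by (simp add: a_inv_def)
qed

definition lambda_map :: "('a, 'm) ring_scheme \<Rightarrow> 'a \<Rightarrow> 'a \<Rightarrow> 'a" where
  "lambda_map A a b = (\<ominus>\<^bsub>A\<^esub> a) \<oplus>\<^bsub>A\<^esub> (a \<otimes>\<^bsub>A\<^esub> b)"

definition star :: "('a, 'm) ring_scheme \<Rightarrow> 'a \<Rightarrow> 'a \<Rightarrow> 'a" where
  "star A a b = lambda_map A a b \<ominus>\<^bsub>A\<^esub> b"

definition brace_ideal :: "('a, 'm) ring_scheme \<Rightarrow> 'a set \<Rightarrow> bool" where
  "brace_ideal A I \<longleftrightarrow>
     I \<lhd> add_monoid A \<and>
     (\<forall>a\<in>carrier A. lambda_map A a ` I \<subseteq> I) \<and>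
     I \<lhd> A"

text \<open>
  For an ideal \<open>I\<close> the cosets \<open>a + I = I + a = a \<circ> I = I \<circ> a\<close> coincide, so both operations of
  \<open>A/I\<close> are the usual products of cosets.
\<close>

definition quotient_brace :: "('a, 'm) ring_scheme \<Rightarrow> 'a set \<Rightarrow> 'a set ring" where
  "quotient_brace A I =
     \<lparr>carrier = a_rcosets\<^bsub>A\<^esub> I, mult = set_mult A, one = I, zero = I, add = set_add A\<rparr>"

definition star_ideal :: "('a, 'm) ring_scheme \<Rightarrow> 'a set \<Rightarrow> 'a set \<Rightarrow> 'a set" where
  "star_ideal A I J = generate (add_monoid A) {star A x y | x y. x \<in> I \<and> y \<in> J}"

definition maximal_brace_ideal :: "('a, 'm) ring_scheme \<Rightarrow> 'a set \<Rightarrow> bool" where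
  "maximal_brace_ideal A M \<longleftrightarrow>
     brace_ideal A M \<and> M \<noteq> carrier A \<and>
     \<not> (\<exists>J. brace_ideal A J \<and> J \<noteq> carrier A \<and> M \<subset> J)"

definition Rad :: "('a, 'm) ring_scheme \<Rightarrow> 'a set" where
  "Rad A = (if \<exists>M. maximal_brace_ideal A M then \<Inter> {M. maximal_brace_ideal A M} else carrier A)"

text \<open>As in the source, the zero brace counts as simple (and as prime).\<close>

definition simple_brace :: "('a, 'm) ring_scheme \<Rightarrow> bool" where
  "simple_brace A \<longleftrightarrow>
     skew_left_brace A \<and> (\<forall>I. brace_ideal A I \<longrightarrow> I = {\<zero>\<^bsub>A\<^esub>} \<or> I = carrier A)"

definition prime_brace :: "('a, 'm) ring_scheme \<Rightarrow> bool" where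
  "prime_brace A \<longleftrightarrow>
     skew_left_brace A \<and>
     (\<forall>I J. brace_ideal A I \<and> brace_ideal A J \<and> I \<noteq> {\<zero>\<^bsub>A\<^esub>} \<and> J \<noteq> {\<zero>\<^bsub>A\<^esub>}
        \<longrightarrow> star_ideal A I J \<noteq> {\<zero>\<^bsub>A\<^esub>})"

definition artinian_brace :: "('a, 'm) ring_scheme \<Rightarrow> bool" where
  "artinian_brace A \<longleftrightarrow>
     skew_left_brace A \<and>
     (\<forall>I :: nat \<Rightarrow> 'a set. (\<forall>n. brace_ideal A (I n)) \<and> (\<forall>n. I (Suc n) \<subseteq> I n)
        \<longrightarrow> (\<exists>N. \<forall>n\<ge>N. I n = I N))"

definition product_brace :: "'i set \<Rightarrow> ('i \<Rightarrow> ('a, 'm) ring_scheme) \<Rightarrow> ('i \<Rightarrow> 'a) ring" where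
  "product_brace K S =
     \<lparr>carrier = (\<Pi>\<^sub>E i\<in>K. carrier (S i)),
      mult = (\<lambda>x y. \<lambda>i\<in>K. x i \<otimes>\<^bsub>S i\<^esub> y i),
      one = (\<lambda>i\<in>K. \<one>\<^bsub>S i\<^esub>),
      zero = (\<lambda>i\<in>K. \<zero>\<^bsub>S i\<^esub>),
      add = (\<lambda>x y. \<lambda>i\<in>K. x i \<oplus>\<^bsub>S i\<^esub> y i)\<rparr>"

definition brace_isomorphic :: "('a, 'm) ring_scheme \<Rightarrow> ('b, 'n) ring_scheme \<Rightarrow> bool" where
  "brace_isomorphic A B \<longleftrightarrow> (\<exists>h. h \<in> iso A B \<and> h \<in> iso (add_monoid A) (add_monoid B))"

end

theory Submission
  imports Defs
begin

text \<open>
  By the descending chain condition, \<open>Rad A\<close> is the intersection of a finite set of maximal ideals;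
  take such a set \<open>F\<close> of least size.  For \<open>M \<in> F\<close> the intersection of the other members is not
  contained in \<open>M\<close>, so its image in the simple brace \<open>A/M\<close> is a non-zero ideal and hence everything.
  This is what the Chinese remainder argument needs to show that \<open>A \<rightarrow> \<Prod>\<^bsub>M\<in>F\<^esub> A/M\<close> is onto.

  If \<open>A\<close> is prime and \<open>Rad A = 0\<close>, then \<open>M\<close> and the (non-zero) intersection \<open>N\<close> of the other members
  satisfy \<open>M * N \<subseteq> M \<inter> N = 0\<close>, so \<open>M = 0\<close> is maximal.
\<close>

text \<open>The rewrites restate the group facts about \<open>add_monoid A\<close> in brace
  notation, so that they combine with facts about \<open>\<otimes>\<close>.\<close>

sublocale skew_left_brace \<subseteq> add: group "add_monoid A"
  rewrites "carrier (add_monoid A) = carrier A"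
    and "mult (add_monoid A) = add A"
    and "one (add_monoid A) = zero A"
    and "m_inv (add_monoid A) = a_inv A"
  by (rule additive_group) (simp_all add: a_inv_def[abs_def] fun_eq_iff)

sublocale skew_left_brace \<subseteq> mult: group A
  by (rule multiplicative_group)

section \<open>Lambda maps and ideals\<close>

context skew_left_brace
begin

lemma lambda_closed: "\<lbrakk>a \<in> carrier A; b \<in> carrier A\<rbrakk> \<Longrightarrow> lambda_map A a b \<in> carrier A"
  by (simp add: lambda_map_def)

lemma mult_eq_add_lambda:
  "\<lbrakk>a \<in> carrier A; b \<in> carrier A\<rbrakk> \<Longrightarrow> a \<otimes> b = a \<oplus> lambda_map A a b"
  by (simp add: lambda_map_def add.m_assoc[symmetric])

text \<open>Since \<open>inv a \<otimes> a\<close> is the common identity, the brace law leaves only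
  \<open>\<ominus> (inv a)\<close> in front of \<open>inv a \<otimes> b\<close>. This serves to
  rewrite additive cosets as multiplicative ones.\<close>

lemma inv_mult_add:
  assumes "a \<in> carrier A" "b \<in> carrier A"
  shows "inv a \<otimes> (a \<oplus> b) = lambda_map A (inv a) b"
  using assms by (simp add: brace_distrib one_eq_zero lambda_map_def a_minus_def)

lemma brace_ideal_iff:
  "brace_ideal A I \<longleftrightarrow>
     subgroup I (add_monoid A) \<and> (\<forall>x\<in>carrier A. \<forall>h\<in>I. x \<oplus> h \<oplus> \<ominus> x \<in> I) \<and>
     (\<forall>a\<in>carrier A. \<forall>h\<in>I. lambda_map A a h \<in> I) \<and>
     subgroup I A \<and> (\<forall>x\<in>carrier A. \<forall>h\<in>I. x \<otimes> h \<otimes> inv x \<in> I)"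
  unfolding brace_ideal_def add.normal_inv_iff mult.normal_inv_iff by blast

lemma ideal_subset: "brace_ideal A I \<Longrightarrow> I \<subseteq> carrier A"
  by (simp add: brace_ideal_iff subgroup.subset)

lemma ideal_zero: "brace_ideal A I \<Longrightarrow> \<zero> \<in> I"
  using subgroup.one_closed[of I "add_monoid A"] by (simp add: brace_ideal_iff)

lemma brace_ideal_zero: "brace_ideal A {\<zero>}"
  using add.triv_subgroup mult.triv_subgroup
  by (auto simp: brace_ideal_iff lambda_map_def one_eq_zero[symmetric] mult.r_inv)
     (simp_all add: one_eq_zero)

lemma brace_ideal_carrier: "brace_ideal A (carrier A)"
  using add.subgroup_self mult.subgroup_self by (auto simp: brace_ideal_iff lambda_closed)

lemma brace_ideal_Int: "\<lbrakk>brace_ideal A I; brace_ideal A J\<rbrakk> \<Longrightarrow> brace_ideal A (I \<inter> J)"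
  by (auto simp: brace_ideal_def image_subset_iff add.normal_subgroup_intersect
      mult.normal_subgroup_intersect)

text \<open>\<open>\<Inter>F\<close> is \<open>UNIV\<close> for empty \<open>F\<close>; intersecting
  with \<open>carrier A\<close> makes the empty family yield the whole brace.\<close>

lemma brace_ideal_Inter_finite:
  "\<lbrakk>finite F; \<forall>M\<in>F. brace_ideal A M\<rbrakk> \<Longrightarrow> brace_ideal A (carrier A \<inter> \<Inter>F)"
proof (induction F rule: finite_induct)
  case empty
  then show ?case by (simp add: brace_ideal_carrier)
next
  case (insert M F)
  then have "brace_ideal A (M \<inter> (carrier A \<inter> \<Inter>F))"
    by (intro brace_ideal_Int[of M]) simp_all
  moreover have "M \<inter> (carrier A \<inter> \<Inter>F) = carrier A \<inter> \<Inter>(insert M F)" by auto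
  ultimately show ?case by (simp only:)
qed

section \<open>Cosets of ideals and the quotient brace\<close>

lemma add_coset_eq_mult_coset:
  assumes I: "brace_ideal A I" and a: "a \<in> carrier A"
  shows "I +> a = I #> a"
proof -
  have sub: "I \<subseteq> carrier A" and lam: "\<And>c h. \<lbrakk>c \<in> carrier A; h \<in> I\<rbrakk> \<Longrightarrow> lambda_map A c h \<in> I"
    using I by (auto simp: ideal_subset brace_ideal_iff)
  \<comment> \<open>\<open>a \<oplus> h = a \<otimes> lambda_map A (inv a) h\<close> gives one
    inclusion of left cosets and \<open>a \<otimes> h = a \<oplus> lambda_map A a h\<close> the
    other; both use that the lambda maps preserve \<open>I\<close>.\<close>
  have "a \<oplus> h \<in> a <# I" if "h \<in> I" for h
  proof -
    have h: "h \<in> carrier A" using that sub by blast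
    have "a \<oplus> h = a \<otimes> (inv a \<otimes> (a \<oplus> h))"
      using a h by (simp add: mult.m_assoc[symmetric])
    then have "a \<oplus> h = a \<otimes> lambda_map A (inv a) h"
      using a h by (simp add: inv_mult_add)
    then show ?thesis
      using lam[of "inv a" h] a that by (auto simp: l_coset_def)
  qed
  moreover have "a \<otimes> h \<in> a <+ I" if "h \<in> I" for h
    using mult_eq_add_lambda[of a h] lam[OF a that] a that sub by (auto simp: a_l_coset_def')
  ultimately have "a <+ I = a <# I"
    by (auto simp: a_l_coset_def' l_coset_def)
  \<comment> \<open>Normality in each of the two groups turns the equal left cosets into right
    cosets.\<close>
  moreover have "I +> a = a <+ I"
    using I a normal.coset_eq[of I "add_monoid A"]
    by (simp add: brace_ideal_def a_r_coset_def a_l_coset_def)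
  moreover have "I #> a = a <# I"
    using I a normal.coset_eq[of I A] by (simp add: brace_ideal_def)
  ultimately show ?thesis by simp
qed

lemma coset_add:
  "\<lbrakk>brace_ideal A I; a \<in> carrier A; b \<in> carrier A\<rbrakk> \<Longrightarrow> (I +> a) <+> (I +> b) = I +> (a \<oplus> b)"
  using normal.rcos_sum[of I "add_monoid A" a b]
  by (simp add: brace_ideal_def a_r_coset_def set_add_def)

lemma coset_mult:
  "\<lbrakk>brace_ideal A I; a \<in> carrier A; b \<in> carrier A\<rbrakk> \<Longrightarrow> (I +> a) <#> (I +> b) = I +> (a \<otimes> b)"
  using normal.rcos_sum[of I A a b] by (simp add: brace_ideal_def add_coset_eq_mult_coset)

lemma coset_zero: "brace_ideal A I \<Longrightarrow> I +> \<zero> = I"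
  using add.coset_mult_one[of I] ideal_subset[of I] by (simp add: a_r_coset_def)

lemma coset_eq_ideal_iff:
  assumes "brace_ideal A I" "a \<in> carrier A"
  shows "I +> a = I \<longleftrightarrow> a \<in> I"
  using assms add.coset_join1[of I a] add.coset_join2[of a I]
  by (auto simp: brace_ideal_iff a_r_coset_def)

text \<open>Lets the factor groups of both operations share the carrier of
  \<open>quotient_brace A I\<close>.\<close>

lemma a_rcosets_eq_rcosets: "brace_ideal A I \<Longrightarrow> a_rcosets I = rcosets I"
  using add_coset_eq_mult_coset[of I]
  by (auto simp: A_RCOSETS_def RCOSETS_def a_r_coset_def)

lemma coset_hom:
  assumes "brace_ideal A I"
  shows "(\<lambda>a. I +> a) \<in> hom A (quotient_brace A I)"
    and "(\<lambda>a. I +> a) \<in> hom (add_monoid A) (add_monoid (quotient_brace A I))"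
    and "(\<lambda>a. I +> a) ` carrier A = carrier (quotient_brace A I)"
  using assms
  by (auto simp: hom_def quotient_brace_def coset_add coset_mult A_RCOSETS_def RCOSETS_def
      a_r_coset_def[symmetric])

end

section \<open>Surjective brace homomorphisms\<close>

lemma skew_left_brace_surj_image:
  assumes "skew_left_brace A"
    and hm: "h \<in> hom A B" and ha: "h \<in> hom (add_monoid A) (add_monoid B)"
    and surj: "h ` carrier A = carrier B"
    and one: "h \<one>\<^bsub>A\<^esub> = \<one>\<^bsub>B\<^esub>" and zero: "h \<zero>\<^bsub>A\<^esub> = \<zero>\<^bsub>B\<^esub>"
  shows "skew_left_brace B"
proof -
  interpret A: skew_left_brace A by fact
  \<comment> \<open>The image group has the image of the identity as its identity. As
    \<open>B\<close> is not yet known to be a group, the hypotheses \<open>one\<close> and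
    \<open>zero\<close> are what identify this element with the identities of
    \<open>B\<close>.\<close>
  have gm: "group B"
    using A.mult.hom_imp_img_group[OF hm] by (simp add: surj one)
  have ga: "group (add_monoid B)"
    using group.hom_imp_img_group[OF A.additive_group ha] by (simp add: surj zero)
  have inv: "h (\<ominus>\<^bsub>A\<^esub> a) = \<ominus>\<^bsub>B\<^esub> h a" if "a \<in> carrier A" for a
    using group_hom.hom_inv[of "add_monoid A" "add_monoid B" h a] A.additive_group ga ha that
    by (simp add: group_hom_def group_hom_axioms_def a_inv_def)
  have add: "h (a \<oplus>\<^bsub>A\<^esub> b) = h a \<oplus>\<^bsub>B\<^esub> h b" if "a \<in> carrier A" "b \<in> carrier A" for a b
    using hom_mult[OF ha] that by simp
  have mult: "h (a \<otimes>\<^bsub>A\<^esub> b) = h a \<otimes>\<^bsub>B\<^esub> h b" if "a \<in> carrier A" "b \<in> carrier A" for a b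
    using hom_mult[OF hm] that by simp
  have "x \<otimes>\<^bsub>B\<^esub> (y \<oplus>\<^bsub>B\<^esub> z) = ((x \<otimes>\<^bsub>B\<^esub> y) \<ominus>\<^bsub>B\<^esub> x) \<oplus>\<^bsub>B\<^esub> (x \<otimes>\<^bsub>B\<^esub> z)"
    if xyz: "x \<in> carrier B" "y \<in> carrier B" "z \<in> carrier B" for x y z
  proof -
    have "x \<in> h ` carrier A" "y \<in> h ` carrier A" "z \<in> h ` carrier A"
      using xyz by (simp_all add: surj)
    then obtain a b c where abc: "a \<in> carrier A" "b \<in> carrier A" "c \<in> carrier A"
      and eq: "x = h a" "y = h b" "z = h c"
      by (elim imageE)
    have "h (a \<otimes>\<^bsub>A\<^esub> (b \<oplus>\<^bsub>A\<^esub> c)) = h (((a \<otimes>\<^bsub>A\<^esub> b) \<ominus>\<^bsub>A\<^esub> a) \<oplus>\<^bsub>A\<^esub> (a \<otimes>\<^bsub>A\<^esub> c))"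
      using A.brace_distrib[OF abc] by simp
    then show ?thesis
      using abc by (simp add: eq add mult a_minus_def inv)
  qed
  then show ?thesis
    using ga gm by (intro skew_left_brace.intro)
qed

lemma (in group_hom) subgroup_vimage:
  assumes "subgroup J H"
  shows "subgroup {a \<in> carrier G. h a \<in> J} G"
proof -
  interpret J: subgroup J H by fact
  show ?thesis by (rule G.subgroupI) auto
qed

text \<open>Its two instances below are the projection to a quotient and the map from
  \<open>A\<close> into a product of quotients.\<close>

locale surj_brace_hom = A: skew_left_brace A + B: skew_left_brace B
  for A :: "('a, 'm) ring_scheme" and B :: "('b, 'n) ring_scheme" and h +
  assumes hom_mult: "h \<in> hom A B"
    and hom_add: "h \<in> hom (add_monoid A) (add_monoid B)"
    and surj: "h ` carrier A = carrier B"

sublocale surj_brace_hom \<subseteq> add: group_hom "add_monoid A" "add_monoid B" h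
  by (intro group_hom.intro group_hom_axioms.intro hom_add A.additive_group B.additive_group)

sublocale surj_brace_hom \<subseteq> mult: group_hom A B h
  by (intro group_hom.intro group_hom_axioms.intro hom_mult A.multiplicative_group
      B.multiplicative_group)

context surj_brace_hom
begin

lemma hom_closed: "a \<in> carrier A \<Longrightarrow> h a \<in> carrier B"
  using surj by blast

lemma hom_lambda:
  assumes "a \<in> carrier A" "b \<in> carrier A"
  shows "h (lambda_map A a b) = lambda_map B (h a) (h b)"
proof -
  have "h (\<ominus>\<^bsub>A\<^esub> a \<oplus>\<^bsub>A\<^esub> (a \<otimes>\<^bsub>A\<^esub> b)) = h (\<ominus>\<^bsub>A\<^esub> a) \<oplus>\<^bsub>B\<^esub> h (a \<otimes>\<^bsub>A\<^esub> b)"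
    using add.hom_mult[of "\<ominus>\<^bsub>A\<^esub> a" "a \<otimes>\<^bsub>A\<^esub> b"] assms by simp
  moreover have "h (\<ominus>\<^bsub>A\<^esub> a) = \<ominus>\<^bsub>B\<^esub> h a"
    using add.hom_inv[of a] assms by (simp add: a_inv_def)
  ultimately show ?thesis
    using assms by (simp add: lambda_map_def)
qed

text \<open>Surjectivity enters because the conjugating and acting elements range over all of
  \<open>B\<close> and have to be lifted to \<open>A\<close>.\<close>

lemma brace_ideal_image:
  assumes I: "brace_ideal A I"
  shows "brace_ideal B (h ` I)"
  unfolding brace_ideal_def
proof (intro conjI ballI)
  show "h ` I \<lhd> add_monoid B"
    using I surj normal.surj_hom_normal_subgroup[OF _ add.group_hom_axioms]
    by (simp add: brace_ideal_def)
  show "h ` I \<lhd> B"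
    using I surj normal.surj_hom_normal_subgroup[OF _ mult.group_hom_axioms]
    by (simp add: brace_ideal_def)
  fix b assume "b \<in> carrier B"
  then obtain a where a: "a \<in> carrier A" "b = h a" using surj by blast
  show "lambda_map B b ` (h ` I) \<subseteq> h ` I"
  proof clarify
    fix x assume x: "x \<in> I"
    have "h (lambda_map A a x) \<in> h ` I"
      using I a x by (simp add: A.brace_ideal_iff)
    then show "lambda_map B b (h x) \<in> h ` I"
      using A.ideal_subset[OF I] a x by (simp add: hom_lambda subset_iff)
  qed
qed

lemma brace_ideal_vimage:
  assumes J: "brace_ideal B J"
  shows "brace_ideal A {a \<in> carrier A. h a \<in> J}"
proof -
  have ha: "h (a \<oplus>\<^bsub>A\<^esub> b) = h a \<oplus>\<^bsub>B\<^esub> h b" "h (\<ominus>\<^bsub>A\<^esub> a) = \<ominus>\<^bsub>B\<^esub> h a"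
    if "a \<in> carrier A" "b \<in> carrier A" for a b
    using add.hom_mult add.hom_inv that by (simp_all add: a_inv_def)
  have J': "\<And>x. x \<in> carrier B \<Longrightarrow> \<forall>h\<in>J. x \<oplus>\<^bsub>B\<^esub> h \<oplus>\<^bsub>B\<^esub> \<ominus>\<^bsub>B\<^esub> x \<in> J"
    "\<And>x. x \<in> carrier B \<Longrightarrow> \<forall>h\<in>J. lambda_map B x h \<in> J"
    "\<And>x. x \<in> carrier B \<Longrightarrow> \<forall>h\<in>J. x \<otimes>\<^bsub>B\<^esub> h \<otimes>\<^bsub>B\<^esub> inv\<^bsub>B\<^esub> x \<in> J"
    using J by (auto simp: B.brace_ideal_iff)
  have "subgroup {a \<in> carrier A. h a \<in> J} (add_monoid A)"
    using add.subgroup_vimage[of J] J by (simp add: B.brace_ideal_iff)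
  moreover have "subgroup {a \<in> carrier A. h a \<in> J} A"
    using mult.subgroup_vimage[of J] J by (simp add: B.brace_ideal_iff)
  ultimately show ?thesis
    using J' by (simp add: A.brace_ideal_iff ha hom_lambda A.lambda_closed hom_closed)
qed

text \<open>The first isomorphism theorem, applied to both groups. The identities coincide, so both
  kernels are \<open>I\<close>; the cosets coincide, so one and the same induced map is an
  isomorphism for both operations, as \<open>brace_isomorphic\<close> demands.\<close>

lemma quotient_kernel_isomorphic:
  assumes I: "brace_ideal A I" and ker: "{a \<in> carrier A. h a = \<zero>\<^bsub>B\<^esub>} = I"
  shows "brace_isomorphic (quotient_brace A I) B"
proof -
  have "(\<lambda>X. the_elem (h ` X)) \<in> iso (A Mod I) B"
    using mult.FactGroup_iso_set surj ker by (simp add: kernel_def B.one_eq_zero)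
  moreover have "(\<lambda>X. the_elem (h ` X)) \<in> iso (add_monoid A Mod I) (add_monoid B)"
    using add.FactGroup_iso_set surj ker by (simp add: kernel_def)
  ultimately show ?thesis
    unfolding brace_isomorphic_def using I
    by (intro exI[of _ "\<lambda>X. the_elem (h ` X)"])
       (simp add: iso_def hom_def FactGroup_def quotient_brace_def A.a_rcosets_eq_rcosets
          A_RCOSETS_def[symmetric] set_add_def)
qed

end

section \<open>Quotients by maximal ideals\<close>

context skew_left_brace
begin

lemma surj_brace_hom_quotient:
  assumes "brace_ideal A I"
  shows "surj_brace_hom A (quotient_brace A I) (\<lambda>a. I +> a)"
proof -
  have "skew_left_brace (quotient_brace A I)"
    by (rule skew_left_brace_surj_image[OF skew_left_brace_axioms coset_hom[OF assms]])
       (simp_all add: quotient_brace_def one_eq_zero coset_zero assms)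
  then show ?thesis
    by (intro surj_brace_hom.intro surj_brace_hom_axioms.intro coset_hom assms
        skew_left_brace_axioms)
qed

text \<open>Correspondence of ideals: the preimage \<open>K\<close> of an ideal \<open>J\<close> of
  the quotient contains \<open>M\<close>, so maximality leaves \<open>K = M\<close> or
  \<open>K = carrier A\<close>, and \<open>J\<close> is recovered as the image of
  \<open>K\<close>.\<close>

lemma simple_quotient:
  assumes M: "maximal_brace_ideal A M"
  shows "simple_brace (quotient_brace A M)"
proof -
  have I: "brace_ideal A M" using M by (simp add: maximal_brace_ideal_def)
  interpret h: surj_brace_hom A "quotient_brace A M" "\<lambda>a. M +> a"
    by (rule surj_brace_hom_quotient[OF I])
  have "J = {\<zero>\<^bsub>quotient_brace A M\<^esub>} \<or> J = carrier (quotient_brace A M)"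
    if J: "brace_ideal (quotient_brace A M) J" for J
  proof -
    define K where "K = {a \<in> carrier A. M +> a \<in> J}"
    have K: "brace_ideal A K" unfolding K_def by (rule h.brace_ideal_vimage[OF J])
    have JK: "J = (\<lambda>a. M +> a) ` K"
      using h.B.ideal_subset[OF J] unfolding K_def h.surj[symmetric] by blast
    have "M \<in> J"
      using h.B.ideal_zero[OF J] by (simp add: quotient_brace_def)
    then have "x \<in> K" if "x \<in> M" for x
      using that ideal_subset[OF I] coset_eq_ideal_iff[OF I, of x] by (auto simp: K_def)
    then have "M \<subseteq> K" by blast
    then consider "K = M" | "K = carrier A"
      using M K by (auto simp: maximal_brace_ideal_def)
    then show ?thesis
    proof cases
      case 1
      \<comment> \<open>Each element of \<open>M\<close> has the coset \<open>M\<close>, which is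
        the zero of the quotient.\<close>
      then have "J = (\<lambda>a. M) ` M"
        unfolding JK using ideal_subset[OF I] coset_eq_ideal_iff[OF I]
        by (intro image_cong) auto
      then show ?thesis
        using ideal_zero[OF I] by (auto simp: quotient_brace_def)
    next
      case 2
      then show ?thesis using JK h.surj by simp
    qed
  qed
  then show ?thesis
    using h.B.skew_left_brace_axioms by (auto simp: simple_brace_def)
qed

section \<open>Chinese remainder theorem\<close>

lemma coset_meets_ideal:
  assumes M: "maximal_brace_ideal A M" and N: "brace_ideal A N" and "\<not> N \<subseteq> M"
    and a: "a \<in> carrier A"
  shows "\<exists>e\<in>N. M +> e = M +> a"
proof -
  have I: "brace_ideal A M" using M by (simp add: maximal_brace_ideal_def)
  interpret h: surj_brace_hom A "quotient_brace A M" "\<lambda>a. M +> a"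
    by (rule surj_brace_hom_quotient[OF I])
  have "brace_ideal (quotient_brace A M) ((\<lambda>a. M +> a) ` N)"
    by (rule h.brace_ideal_image[OF N])
  \<comment> \<open>An element of \<open>N\<close> outside \<open>M\<close> has a non-zero coset, so
    the image of \<open>N\<close> is a non-zero ideal of a simple brace.\<close>
  moreover obtain e where "e \<in> N" "e \<notin> M" using assms(3) by blast
  then have "(\<lambda>a. M +> a) ` N \<noteq> {M}"
    using coset_eq_ideal_iff[OF I, of e] ideal_subset[OF N] by blast
  ultimately have "(\<lambda>a. M +> a) ` N = carrier (quotient_brace A M)"
    using simple_quotient[OF M] by (auto simp: simple_brace_def quotient_brace_def)
  then show ?thesis
    using h.hom_closed[OF a] by (metis (mono_tags, lifting) imageE)
qed

text \<open>Induction on \<open>n\<close>. The second hypothesis compares each ideal with the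
  intersection of the earlier ones, which is what one step needs: a solution for the first
  \<open>n\<close> ideals is corrected by an element of that intersection.\<close>

lemma chinese_remainder:
  fixes M :: "nat \<Rightarrow> 'a set"
  assumes "\<forall>i<n. maximal_brace_ideal A (M i)"
    and "\<forall>i<n. \<not> carrier A \<inter> \<Inter>(M ` {..<i}) \<subseteq> M i"
    and "\<forall>i<n. y i \<in> carrier A"
  shows "\<exists>a\<in>carrier A. \<forall>i<n. M i +> a = M i +> y i"
  using assms
proof (induction n)
  case 0
  then show ?case by auto
next
  case (Suc n)
  then obtain a where a: "a \<in> carrier A" "\<forall>i<n. M i +> a = M i +> y i"
    by auto
  have I: "brace_ideal A (M i)" if "i \<le> n" for i
    using Suc.prems(1) that by (simp add: maximal_brace_ideal_def)
  define N where "N = carrier A \<inter> \<Inter>(M ` {..<n})"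
  have N: "brace_ideal A N"
    unfolding N_def by (rule brace_ideal_Inter_finite) (auto simp: I)
  have y: "y n \<in> carrier A" using Suc.prems(3) by simp
  \<comment> \<open>Lying in \<open>N\<close>, \<open>e\<close> vanishes modulo all earlier ideals,
    so adding it keeps their congruences. Modulo \<open>M n\<close> it is the difference that turns
    \<open>a\<close> into \<open>y n\<close> when added on the right; addition need not
    commute.\<close>
  obtain e where e: "e \<in> N" "M n +> e = M n +> (\<ominus> a \<oplus> y n)"
    using coset_meets_ideal[of "M n" N "\<ominus> a \<oplus> y n"] Suc.prems N a y by (auto simp: N_def)
  have ec: "e \<in> carrier A" using e(1) by (simp add: N_def)
  have "M n +> (a \<oplus> e) = M n +> (a \<oplus> (\<ominus> a \<oplus> y n))"
    using coset_add[OF I[of n] a(1)] e ec a y by (metis add.inv_closed add.m_closed le_refl)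
  then have "M n +> (a \<oplus> e) = M n +> y n"
    using a y by (simp add: add.m_assoc[symmetric])
  moreover have "M i +> (a \<oplus> e) = M i +> y i" if i: "i < n" for i
  proof -
    have "M i +> e = M i"
      using e(1) ec i coset_eq_ideal_iff[OF I[of i]] by (simp add: N_def)
    then have "M i +> (a \<oplus> e) = (M i +> a) <+> (M i +> \<zero>)"
      using coset_add[OF I[of i] a(1) ec] coset_zero[OF I[of i]] i by simp
    then show ?thesis
      using coset_add[OF I[of i] a(1)] a i by simp
  qed
  ultimately show ?case
    using a(1) ec by (intro bexI[of _ "a \<oplus> e"]) (auto simp: less_Suc_eq)
qed

text \<open>The kernel of the map into the product is the intersection, and the Chinese remainder
  theorem makes the map onto. For \<open>n = 0\<close> both sides are zero braces.\<close>

lemma quotient_Inter_isomorphic_product: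
  fixes M :: "nat \<Rightarrow> 'a set"
  assumes M: "\<forall>i<n. maximal_brace_ideal A (M i)"
    and irr: "\<forall>i<n. \<not> carrier A \<inter> \<Inter>(M ` {..<i}) \<subseteq> M i"
  shows "brace_isomorphic (quotient_brace A (carrier A \<inter> \<Inter>(M ` {..<n})))
           (product_brace {..<n} (\<lambda>i. quotient_brace A (M i)))"
proof -
  let ?P = "product_brace {..<n} (\<lambda>i. quotient_brace A (M i))"
  \<comment> \<open>The restriction gives \<open>undefined\<close> outside \<open>{..<n}\<close>, as
    the extensional product requires.\<close>
  define h where "h a = (\<lambda>i\<in>{..<n}. M i +> a)" for a
  have I: "brace_ideal A (M i)" if "i < n" for i
    using M that by (simp add: maximal_brace_ideal_def)
  have cl: "M i +> a \<in> carrier (quotient_brace A (M i))" if "i < n" "a \<in> carrier A" for i a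
    using coset_hom(3)[OF I[OF that(1)]] that(2) by blast
  have hc: "h a \<in> carrier ?P" if "a \<in> carrier A" for a
    using that by (simp add: product_brace_def h_def cl)
  have hm: "h \<in> hom A ?P"
    using hc by (auto simp: hom_def)
      (auto simp: product_brace_def h_def quotient_brace_def coset_mult[OF I] fun_eq_iff)
  have ha: "h \<in> hom (add_monoid A) (add_monoid ?P)"
    using hc by (auto simp: hom_def)
      (auto simp: product_brace_def h_def quotient_brace_def coset_add[OF I] fun_eq_iff)
  have surj: "h ` carrier A = carrier ?P"
  proof (intro subset_antisym image_subsetI hc subsetI)
    fix Y assume Y: "Y \<in> carrier ?P"
    have "\<exists>a\<in>carrier A. Y i = M i +> a" if "i < n" for i
    proof -
      have "Y i \<in> carrier (quotient_brace A (M i))"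
        using Y that by (auto simp: product_brace_def)
      then show ?thesis using coset_hom(3)[OF I[OF that]] by auto
    qed
    then obtain y where y: "\<forall>i<n. y i \<in> carrier A \<and> Y i = M i +> y i" by metis
    then obtain a where a: "a \<in> carrier A" "\<forall>i<n. M i +> a = M i +> y i"
      using chinese_remainder[OF M irr, of y] by auto
    have "Y = h a"
      using Y y a(2) by (intro extensionalityI[of _ "{..<n}"])
        (auto simp: h_def product_brace_def PiE_def)
    then show "Y \<in> h ` carrier A" using a(1) by blast
  qed
  have z: "h \<zero> = \<zero>\<^bsub>?P\<^esub>" and o: "h \<one> = \<one>\<^bsub>?P\<^esub>"
    by (simp_all add: h_def product_brace_def quotient_brace_def one_eq_zero coset_zero[OF I]
        cong: restrict_cong)
  \<comment> \<open>The product inherits the brace axioms as an image of \<open>A\<close>.\<close>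
  have "skew_left_brace ?P"
    by (rule skew_left_brace_surj_image[OF skew_left_brace_axioms hm ha surj o z])
  then interpret h: surj_brace_hom A ?P h
    by (intro surj_brace_hom.intro surj_brace_hom_axioms.intro hm ha surj skew_left_brace_axioms)
  have "h a = \<zero>\<^bsub>?P\<^esub> \<longleftrightarrow> (\<forall>i<n. a \<in> M i)" if "a \<in> carrier A" for a
    using coset_eq_ideal_iff[OF I that]
    by (auto simp: h_def product_brace_def quotient_brace_def fun_eq_iff restrict_def)
  then have "{a \<in> carrier A. h a = \<zero>\<^bsub>?P\<^esub>} = carrier A \<inter> \<Inter>(M ` {..<n})"
    by auto
  moreover have "brace_ideal A (carrier A \<inter> \<Inter>(M ` {..<n}))"
    by (rule brace_ideal_Inter_finite) (auto simp: I)
  ultimately show ?thesis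
    by (intro h.quotient_kernel_isomorphic)
qed

section \<open>The radical and the descending chain condition\<close>

lemma Rad_eq: "Rad A = carrier A \<inter> \<Inter>{M. maximal_brace_ideal A M}"
  \<comment> \<open>Without maximal ideals the intersection is \<open>UNIV\<close>, and
    \<open>carrier A\<close> supplies the default value of \<open>Rad\<close>.\<close>
  using ideal_subset by (auto simp: Rad_def maximal_brace_ideal_def)

lemma finite_imp_artinian:
  assumes fin: "finite (carrier A)"
  shows "artinian_brace A"
  unfolding artinian_brace_def
proof (intro conjI allI impI skew_left_brace_axioms; elim conjE)
  fix I :: "nat \<Rightarrow> 'a set"
  assume I: "\<forall>n. brace_ideal A (I n)" and dec: "\<forall>n. I (Suc n) \<subseteq> I n"
  \<comment> \<open>\<open>N\<close> is an index of least cardinality; a later member lies inside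
    \<open>I N\<close> and has at least as many elements, hence equals it.\<close>
  obtain N where N: "\<And>n. card (I N) \<le> card (I n)"
    using arg_min_nat_le[of "\<lambda>_. True" _ "\<lambda>n. card (I n)"] by blast
  have "I n = I N" if "n \<ge> N" for n
  proof (rule card_seteq)
    show "finite (I N)" using fin I ideal_subset finite_subset by blast
    show "I n \<subseteq> I N" using lift_Suc_antimono_le[of I N n] dec that by blast
  qed (rule N)
  then show "\<exists>N. \<forall>n\<ge>N. I n = I N" by blast
qed

text \<open>If every member of \<open>Q\<close> had a strictly smaller one in \<open>Q\<close>,
  iterating a choice of such members from \<open>I0\<close> would give a strictly descending
  chain.\<close>

lemma artinian_minimal_ideal:
  assumes "artinian_brace A" and "\<forall>I\<in>Q. brace_ideal A I" and "I0 \<in> Q"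
  shows "\<exists>I\<in>Q. \<forall>J\<in>Q. \<not> J \<subset> I"
proof (rule ccontr)
  assume "\<not> ?thesis"
  then have "\<forall>I. \<exists>J. I \<in> Q \<longrightarrow> J \<in> Q \<and> J \<subset> I" by blast
  then obtain f where f: "\<And>I. I \<in> Q \<Longrightarrow> f I \<in> Q \<and> f I \<subset> I" by metis
  define s where "s n = (f ^^ n) I0" for n
  have s: "s n \<in> Q" for n
    by (induction n) (use assms(3) f in \<open>auto simp: s_def\<close>)
  have dec: "s (Suc n) \<subset> s n" for n
    using f[OF s[of n]] by (simp add: s_def)
  have "\<exists>N. \<forall>n\<ge>N. s n = s N"
    using assms(1,2) s dec unfolding artinian_brace_def by blast
  then obtain N where "s (Suc N) = s N" by (meson le_Suc_eq order_refl)
  then show False using dec[of N] by simp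
qed

lemma artinian_Rad_finite_Inter:
  assumes "artinian_brace A"
  obtains F where "finite F" "\<forall>M\<in>F. maximal_brace_ideal A M" "Rad A = carrier A \<inter> \<Inter>F"
    "\<And>M. M \<in> F \<Longrightarrow> \<not> carrier A \<inter> \<Inter>(F - {M}) \<subseteq> M"
proof -
  \<comment> \<open>\<open>P\<close> singles out the finite families of maximal ideals, and
    \<open>D\<close> forms their intersections. The empty family is allowed, so there is always a
    candidate for a minimal \<open>D F\<close>.\<close>
  define P where "P F \<longleftrightarrow> finite F \<and> (\<forall>M\<in>F. maximal_brace_ideal A M)" for F
  define D where "D F = carrier A \<inter> \<Inter>F" for F
  have "brace_ideal A (D F)" if "P F" for F
    using that brace_ideal_Inter_finite[of F] by (simp add: P_def D_def maximal_brace_ideal_def)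
  then have "\<forall>I \<in> D ` Collect P. brace_ideal A I" by simp
  moreover have "D {} \<in> D ` Collect P"
    by (intro imageI) (simp add: P_def)
  ultimately have "\<exists>I \<in> D ` Collect P. \<forall>J \<in> D ` Collect P. \<not> J \<subset> I"
    by (rule artinian_minimal_ideal[OF assms])
  then obtain F where F: "P F" and min: "\<And>G. P G \<Longrightarrow> \<not> D G \<subset> D F"
    by auto
  have "D F \<subseteq> M" if "maximal_brace_ideal A M" for M
  proof -
    \<comment> \<open>Adjoining \<open>M\<close> cannot shrink the minimal intersection, which
      therefore already lies in \<open>M\<close>.\<close>
    have "\<not> D (insert M F) \<subset> D F"
      using F that by (intro min) (simp add: P_def)
    moreover have "D (insert M F) = D F \<inter> M" by (auto simp: D_def)
    ultimately show ?thesis by blast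
  qed
  then have "D F \<subseteq> Rad A"
    unfolding Rad_eq by (auto simp: D_def)
  moreover have "Rad A \<subseteq> D F"
    using F unfolding Rad_eq D_def P_def by blast
  ultimately have ex: "P F \<and> Rad A = carrier A \<inter> \<Inter>F"
    using F unfolding D_def by (intro conjI equalityI)
  obtain G where G: "P G" "Rad A = carrier A \<inter> \<Inter>G"
    and least: "\<And>G'. P G' \<and> Rad A = carrier A \<inter> \<Inter>G' \<Longrightarrow> card G \<le> card G'"
    using ex_has_least_nat[of "\<lambda>F. P F \<and> Rad A = carrier A \<inter> \<Inter>F", OF ex, of card] by blast
  have "\<not> carrier A \<inter> \<Inter>(G - {M}) \<subseteq> M" if M: "M \<in> G" for M
  proof
    assume "carrier A \<inter> \<Inter>(G - {M}) \<subseteq> M"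
    then have "Rad A = carrier A \<inter> \<Inter>(G - {M})" using G(2) by blast
    then have "card G \<le> card (G - {M})" using least[of "G - {M}"] G(1) by (simp add: P_def)
    then show False using card_Diff1_less[of G M] G(1) M by (simp add: P_def)
  qed
  then show ?thesis using that[of G] G by (simp add: P_def)
qed

lemma artinian_quotient_Rad:
  assumes "artinian_brace A"
  shows "\<exists>(n::nat) (S :: nat \<Rightarrow> 'a set ring). (\<forall>i<n. simple_brace (S i)) \<and>
    brace_isomorphic (quotient_brace A (Rad A)) (product_brace {..<n} S)"
proof -
  obtain F where F: "finite F" "\<forall>M\<in>F. maximal_brace_ideal A M" "Rad A = carrier A \<inter> \<Inter>F"
    and irr: "\<And>M. M \<in> F \<Longrightarrow> \<not> carrier A \<inter> \<Inter>(F - {M}) \<subseteq> M"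
    using artinian_Rad_finite_Inter[OF assms] by blast
  obtain M where M: "bij_betw M {..<card F} F"
    using ex_bij_betw_nat_finite[OF F(1)] by (auto simp: atLeast0LessThan)
  have img: "M ` {..<card F} = F" using M by (rule bij_betw_imp_surj_on)
  have mem: "M i \<in> F" if "i < card F" for i using img that by blast
  have "\<not> carrier A \<inter> \<Inter>(M ` {..<i}) \<subseteq> M i" if i: "i < card F" for i
  proof -
    \<comment> \<open>As the enumeration is injective, the ideals before \<open>M i\<close> all
      belong to \<open>F - {M i}\<close>. Their intersection contains that of
      \<open>F - {M i}\<close> and so is not inside \<open>M i\<close>.\<close>
    have "M j \<noteq> M i" if "j < i" for j
      using inj_onD[OF bij_betw_imp_inj_on[OF M], of j i] i that by auto
    then have "M ` {..<i} \<subseteq> F - {M i}"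
      using mem i by auto
    then show ?thesis using irr[OF mem[OF i]] by blast
  qed
  then have "brace_isomorphic (quotient_brace A (Rad A))
      (product_brace {..<card F} (\<lambda>i. quotient_brace A (M i)))"
    using quotient_Inter_isomorphic_product[of "card F" M] F mem by (simp add: img)
  moreover have "\<forall>i<card F. simple_brace (quotient_brace A (M i))"
    using F(2) mem by (auto intro: simple_quotient)
  ultimately show ?thesis
    by (intro exI[of _ "card F"] exI[of _ "\<lambda>i. quotient_brace A (M i)"] conjI)
qed

section \<open>Star products and prime braces\<close>

lemma star_mem_left:
  assumes I: "brace_ideal A I" and x: "x \<in> I" and y: "y \<in> carrier A"
  shows "star A x y \<in> I"
proof -
  have xc: "x \<in> carrier A" using ideal_subset[OF I] x by blast
  interpret sa: subgroup I "add_monoid A" using I by (simp add: brace_ideal_iff)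
  \<comment> \<open>The conjugate \<open>z\<close> satisfies
    \<open>x \<otimes> y = y \<otimes> z\<close>, which moves \<open>y\<close> to the front:
    \<open>star A x y\<close> becomes \<open>\<ominus> x\<close> plus the additive conjugate by
    \<open>y\<close> of \<open>lambda_map A y z\<close>, and both summands lie in
    \<open>I\<close>.\<close>
  define z where "z = inv y \<otimes> x \<otimes> y"
  have zI: "z \<in> I"
    using I x y normal.inv_op_closed1[of I A y x] by (simp add: brace_ideal_def z_def)
  then have zc: "z \<in> carrier A" using ideal_subset[OF I] by blast
  have "x \<otimes> y = y \<otimes> z"
    using xc y by (simp add: z_def mult.m_assoc[symmetric])
  also have "\<dots> = y \<oplus> lambda_map A y z"
    using y zc by (rule mult_eq_add_lambda)
  finally have "star A x y = \<ominus> x \<oplus> (y \<oplus> lambda_map A y z \<oplus> \<ominus> y)"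
    using xc y zc by (simp add: star_def lambda_map_def[of A x] a_minus_def add.m_assoc lambda_closed)
  moreover have "y \<oplus> lambda_map A y z \<oplus> \<ominus> y \<in> I"
    using I y zI by (simp add: brace_ideal_iff)
  moreover have "\<ominus> x \<in> I" using sa.m_inv_closed[OF x] by (simp add: a_inv_def)
  ultimately show ?thesis using sa.m_closed by simp
qed

lemma star_mem_right:
  assumes J: "brace_ideal A J" and x: "x \<in> carrier A" and y: "y \<in> J"
  shows "star A x y \<in> J"
proof -
  interpret sa: subgroup J "add_monoid A" using J by (simp add: brace_ideal_iff)
  have "lambda_map A x y \<in> J" using J x y by (simp add: brace_ideal_iff)
  moreover have "\<ominus> y \<in> J" using sa.m_inv_closed[OF y] by (simp add: a_inv_def)
  ultimately show ?thesis using sa.m_closed by (simp add: star_def a_minus_def)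
qed

lemma star_ideal_subset_Int:
  assumes I: "brace_ideal A I" and J: "brace_ideal A J"
  shows "star_ideal A I J \<subseteq> I \<inter> J"
  unfolding star_ideal_def
proof (rule add.generate_subgroup_incl)
  show "{star A x y | x y. x \<in> I \<and> y \<in> J} \<subseteq> I \<inter> J"
    using star_mem_left[OF I] star_mem_right[OF J] ideal_subset[OF I] ideal_subset[OF J] by blast
  show "subgroup (I \<inter> J) (add_monoid A)"
    using brace_ideal_Int[OF I J] by (simp add: brace_ideal_iff)
qed

text \<open>The zero brace has no proper ideal, hence no maximal one, and \<open>Rad\<close> takes
  its default value there; in any other simple brace \<open>{\<zero>}\<close> is itself
  maximal.\<close>

lemma simple_imp_Rad_zero:
  assumes "simple_brace A"
  shows "Rad A = {\<zero>}"
proof (cases "carrier A = {\<zero>}")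
  case True
  then have "\<not> maximal_brace_ideal A M" for M
    using ideal_zero[of M] ideal_subset[of M] by (auto simp: maximal_brace_ideal_def)
  then show ?thesis using True by (simp add: Rad_def)
next
  case False
  then have "maximal_brace_ideal A {\<zero>}"
    using assms brace_ideal_zero by (auto simp: maximal_brace_ideal_def simple_brace_def)
  moreover have "\<zero> \<in> Rad A"
    using ideal_zero by (auto simp: Rad_eq maximal_brace_ideal_def)
  ultimately show ?thesis by (auto simp: Rad_eq)
qed

text \<open>Every ideal contains zero, so maximality of \<open>{\<zero>}\<close> leaves no other
  proper ideal.\<close>

lemma maximal_zero_imp_simple: "maximal_brace_ideal A {\<zero>} \<Longrightarrow> simple_brace A"
  using ideal_zero skew_left_brace_axioms
  by (auto simp: maximal_brace_ideal_def simple_brace_def)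

lemma prime_Rad_zero_imp_simple:
  assumes "artinian_brace A" and prime: "prime_brace A" and Rad: "Rad A = {\<zero>}"
  shows "simple_brace A"
proof -
  obtain F where F: "finite F" "\<forall>M\<in>F. maximal_brace_ideal A M" "Rad A = carrier A \<inter> \<Inter>F"
    and irr: "\<And>M. M \<in> F \<Longrightarrow> \<not> carrier A \<inter> \<Inter>(F - {M}) \<subseteq> M"
    using artinian_Rad_finite_Inter[OF assms(1)] by blast
  show ?thesis
  proof (cases "F = {}")
    case True
    \<comment> \<open>The empty intersection is all of \<open>A\<close>, so \<open>A\<close> is the
      zero brace, which counts as simple.\<close>
    then have "carrier A = {\<zero>}" using F(3) Rad by simp
    then have "I = {\<zero>}" if "brace_ideal A I" for I
      using ideal_zero[OF that] ideal_subset[OF that] by auto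
    then show ?thesis
      using skew_left_brace_axioms by (simp add: simple_brace_def)
  next
    case False
    then obtain M where M: "M \<in> F" by blast
    \<comment> \<open>For \<open>F = {M}\<close> this is all of \<open>A\<close>, and the argument
      below still applies.\<close>
    define N where "N = carrier A \<inter> \<Inter>(F - {M})"
    have I: "brace_ideal A M" using F(2) M by (simp add: maximal_brace_ideal_def)
    have N: "brace_ideal A N"
      unfolding N_def using F(1,2)
      by (intro brace_ideal_Inter_finite) (auto simp: maximal_brace_ideal_def)
    have "\<not> N \<subseteq> M" using irr[OF M] by (simp only: N_def not_False_eq_True)
    then have "N \<noteq> {\<zero>}" using ideal_zero[OF I] by auto
    moreover have "M \<inter> N = {\<zero>}"
      using F(3) Rad M by (auto simp: N_def)
    then have "star_ideal A M N = {\<zero>}"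
      using star_ideal_subset_Int[OF I N]
        generate.one[of "add_monoid A" "{star A x y | x y. x \<in> M \<and> y \<in> N}"]
      unfolding star_ideal_def by auto
    ultimately have "M = {\<zero>}"
      using prime I N unfolding prime_brace_def by blast
    then have "maximal_brace_ideal A {\<zero>}" using F(2) M by simp
    then show ?thesis by (rule maximal_zero_imp_simple)
  qed
qed

end

theorem theorem3p10:
  fixes A :: "('a, 'm) ring_scheme"
  assumes "skew_left_brace A"
  shows "(finite (carrier A) \<longrightarrow> artinian_brace A) \<and>
    (artinian_brace A \<longrightarrow>
       (\<exists>(n::nat) (S :: nat \<Rightarrow> 'a set ring).
          (\<forall>i<n. simple_brace (S i)) \<and>
          brace_isomorphic (quotient_brace A (Rad A)) (product_brace {..<n} S)) \<and>
       (prime_brace A \<longrightarrow> (simple_brace A \<longleftrightarrow> Rad A = {\<zero>\<^bsub>A\<^esub>})))"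
proof -
  interpret skew_left_brace A by fact
  show ?thesis
    by (intro conjI impI iffI; (rule finite_imp_artinian artinian_quotient_Rad simple_imp_Rad_zero
        prime_Rad_zero_imp_simple; assumption))
qed

end
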